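(* Let $\mathbf{x}=(x_1,\dots,x_d)$ be generated by an additive noise model over a DAG $\mathcal{G}=(\mathcal{V},\mathcal{E})$, $x_i = f_i(\mathbf{x}_{\mathrm{pa}(i)}) + \epsilon_i$ for $i=1,\dots,d$, where the $\epsilon_i$ are mutually independent with $\epsilon_i\sim\mathcal{N}(0,\sigma^2)$ for a common $\sigma^2>0$, and each $f_i$ is twice continuously differentiable, with all expectations below finite. Let $\mathcal{I}=\mathbb{E}_{p(\mathbf{x})}[-\nabla^2_{\mathbf{x}}\log p(\mathbf{x})]$. Then for every $i$, $$\mathcal{I}_{ii} = \frac{1}{\sigma^2} + \frac{1}{\sigma^2}\sum_{j\in\mathrm{ch}(i)} \mathbb{E}_{p(\mathbf{x})}\!\left[\left(\frac{\partial f_j}{\partial x_i}\right)^2\right].$$ Consequently, if moreover for every edge $j\to i\in\mathcal{E}$ one has $\mathbb{E}_{p(\mathbf{x})}[(\partial f_i/\partial x_j)^2]>0$, then a node $l$ satisfies $\mathcal{I}_{ll}=\min_i \mathcal{I}_{ii} = 1/\sigma^2$ if and only if $l$ is a sink of $\mathcal{G}$ (i.e. $\mathrm{ch}(l)=\emptyset$).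
   Context: $\mathrm{pa}(i)$ and $\mathrm{ch}(i)$ denote the parents and children of node $i$ in the DAG $\mathcal{G}$; $\mathbf{x}_{\mathrm{pa}(i)}$ is the subvector of parent coordinates, and $f_i$ is regarded as a function of all of $\mathbf{x}$ depending only on $\mathbf{x}_{\mathrm{pa}(i)}$ (so $\partial f_j/\partial x_i$ is identically zero unless $i\in\mathrm{pa}(j)$). $p(\mathbf{x})$ is the joint density of $\mathbf{x}$. The matrix $\mathcal{I}$ is called the (expected) Score-Jacobian Information Matrix (SJIM). *)

theory Defs
  imports "HOL-Probability.Probability"
begin

definition pa :: "('n \<times> 'n) set \<Rightarrow> 'n \<Rightarrow> 'n set" where
  "pa E i = {j. (j, i) \<in> E}"

definition ch :: "('n \<times> 'n) set \<Rightarrow> 'n \<Rightarrow> 'n set" where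
  "ch E i = {j. (i, j) \<in> E}"

definition partial :: "'n::finite \<Rightarrow> (real^'n \<Rightarrow> real) \<Rightarrow> real^'n \<Rightarrow> real" where
  "partial i g x = deriv (\<lambda>t. g (x + t *\<^sub>R axis i 1)) 0"

definition C2 :: "(real^'n::finite \<Rightarrow> real) \<Rightarrow> bool" where
  "C2 g \<longleftrightarrow> (\<exists>G H. (\<forall>x. (g has_derivative blinfun_apply (G x)) (at x))
     \<and> (\<forall>x. (G has_derivative blinfun_apply (H x)) (at x))
     \<and> continuous_on UNIV H)"

definition SJIM :: "'w measure \<Rightarrow> ('w \<Rightarrow> real^'n::finite) \<Rightarrow> (real^'n \<Rightarrow> real) \<Rightarrow> 'n \<Rightarrow> 'n \<Rightarrow> real" where
  "SJIM M X p i k = (\<integral>\<omega>. - partial i (partial k (\<lambda>y. ln (p y))) (X \<omega>) \<partial>M)"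

end

theory Submission
  imports Defs
begin

text \<open>
  The map \<open>x \<mapsto> x - f x\<close> sends \<open>X\<close> to the noise vector. It is a composition of shears, one per node
  and taken in topological order, so it preserves Lebesgue measure, and the density of \<open>X\<close> at \<open>x\<close>
  is the Gaussian noise density at \<open>x - f x\<close>. Hence
  \<open>- \<partial>\<^sub>i\<partial>\<^sub>i ln p = (\<Sum>j. (\<delta>\<^sub>i\<^sub>j - \<partial>\<^sub>i f\<^sub>j)\<^sup>2 - (x\<^sub>j - f\<^sub>j) \<partial>\<^sub>i\<partial>\<^sub>i f\<^sub>j) / \<sigma>\<^sup>2\<close>.
  At \<open>X\<close> the last factor pairs the centred noise \<open>\<epsilon>\<^sub>j\<close> with a function of the parents of \<open>j\<close>, which
  are independent of \<open>\<epsilon>\<^sub>j\<close>, so that term has mean zero; and \<open>\<partial>\<^sub>i f\<^sub>i = 0\<close> by acyclicity.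
\<close>

section \<open>Lebesgue measure on vectors as a product measure\<close>

lemma borel_measurable_vecI:
  fixes g :: "'a \<Rightarrow> real^'n"
  assumes "\<And>i. (\<lambda>x. g x $ i) \<in> borel_measurable M"
  shows "g \<in> borel_measurable M"
  by (subst borel_measurable_euclidean_space)
    (use assms in \<open>auto simp: Basis_vec_def inner_axis\<close>)

lemma borel_measurable_vec_PiM:
  "(\<lambda>x. \<chi> i. x i) \<in> PiM UNIV (\<lambda>i::'n::finite. lborel :: real measure) \<rightarrow>\<^sub>M (borel :: (real^'n) measure)"
  by (rule borel_measurable_vecI) simp

lemma product_sigma_finite_lborel: "product_sigma_finite (\<lambda>i. lborel :: real measure)"
  by standard

text \<open>Lebesgue measure is determined by its values on boxes, and there the product measure
  also gives the product of the side lengths. This makes integration one coordinate at a time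
  available on \<open>real^'n\<close>.\<close>

lemma lborel_vec_eq_distr_PiM:
  "(lborel :: (real^'n) measure) = distr (PiM UNIV (\<lambda>i::'n::finite. lborel)) borel (\<lambda>x. \<chi> i. x i)"
proof (rule lborel_eqI)
  interpret product_sigma_finite "\<lambda>i::'n. lborel :: real measure"
    by (rule product_sigma_finite_lborel)
  fix l u :: "real^'n"
  assume le: "\<And>b. b \<in> Basis \<Longrightarrow> l \<bullet> b \<le> u \<bullet> b"
  have le': "l $ i \<le> u $ i" for i
    using le[of "axis i 1"] by (simp add: inner_axis axis_in_Basis_iff)
  have "(\<lambda>x. \<chi> i. x i) -` box l u \<inter> space (PiM UNIV (\<lambda>i::'n. lborel :: real measure))
      = (\<Pi>\<^sub>E i\<in>UNIV. {l $ i<..<u $ i})"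
    by (auto simp: space_PiM PiE_def Pi_def mem_box_cart)
  then have "emeasure (distr (PiM UNIV (\<lambda>i::'n. lborel)) borel (\<lambda>x. \<chi> i. x i)) (box l u)
      = (\<Prod>i\<in>UNIV. emeasure lborel {l $ i<..<u $ i})"
    by (subst emeasure_distr[OF borel_measurable_vec_PiM]) (simp_all add: emeasure_PiM)
  also have "\<dots> = (\<Prod>i\<in>UNIV. ennreal (u $ i - l $ i))"
    by (simp add: le')
  also have "\<dots> = ennreal (\<Prod>i\<in>UNIV. u $ i - l $ i)"
    by (rule prod_ennreal) (simp add: le')
  also have "(\<Prod>i\<in>UNIV. u $ i - l $ i) = (\<Prod>b\<in>Basis. (u - l) \<bullet> b)"
  proof -
    have B: "(Basis :: (real^'n) set) = (\<lambda>i. axis i 1) ` UNIV"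
      by (auto simp: Basis_vec_def)
    have "inj (\<lambda>i::'n. axis i (1::real))"
      by (auto simp: inj_on_def axis_eq_axis)
    then show ?thesis
      unfolding B by (subst prod.reindex) (simp_all add: inner_axis)
  qed
  finally show "emeasure (distr (PiM UNIV (\<lambda>i::'n. lborel)) borel (\<lambda>x. \<chi> i. x i)) (box l u)
      = (\<Prod>b\<in>Basis. (u - l) \<bullet> b)" .
qed simp

section \<open>Shears and acyclic shifts preserve Lebesgue measure\<close>

text \<open>Integrate over coordinate \<open>k\<close> innermost: with the other coordinates fixed,
  \<open>g\<close> is constant, so the inner integrand is merely translated.\<close>

lemma nn_integral_lborel_shear:
  fixes h :: "real^'n::finite \<Rightarrow> ennreal" and g :: "real^'n \<Rightarrow> real"
  assumes h[measurable]: "h \<in> borel_measurable borel"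
    and g[measurable]: "g \<in> borel_measurable borel"
    and indep: "\<And>x y. (\<And>j. j \<noteq> k \<Longrightarrow> x $ j = y $ j) \<Longrightarrow> g x = g y"
  shows "(\<integral>\<^sup>+x. h (x - g x *\<^sub>R axis k 1) \<partial>lborel) = (\<integral>\<^sup>+x. h x \<partial>lborel)"
proof -
  interpret product_sigma_finite "\<lambda>i::'n. lborel :: real measure"
    by (rule product_sigma_finite_lborel)
  let ?I = "UNIV - {k}"
  let ?P = "\<lambda>I. PiM I (\<lambda>i::'n. lborel :: real measure)"
  let ?v = "\<lambda>x. (\<chi> i. x i) :: real^'n"
  have ins: "insert k ?I = UNIV" by auto
  have vm[measurable]: "?v \<in> ?P UNIV \<rightarrow>\<^sub>M borel"
    by (rule borel_measurable_vec_PiM)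
  have split: "(\<integral>\<^sup>+x. r x \<partial>lborel) = (\<integral>\<^sup>+x. (\<integral>\<^sup>+y. r (?v (x(k := y))) \<partial>lborel) \<partial>?P ?I)"
    if [measurable]: "r \<in> borel_measurable borel" for r :: "real^'n \<Rightarrow> ennreal"
  proof -
    have "(\<integral>\<^sup>+x. r x \<partial>lborel) = (\<integral>\<^sup>+x. r (?v x) \<partial>?P UNIV)"
      by (subst lborel_vec_eq_distr_PiM, subst nn_integral_distr) auto
    also have "\<dots> = (\<integral>\<^sup>+x. r (?v x) \<partial>?P (insert k ?I))"
      by (simp only: ins)
    also have "\<dots> = (\<integral>\<^sup>+x. (\<integral>\<^sup>+y. r (?v (x(k := y))) \<partial>lborel) \<partial>?P ?I)"
      by (rule product_nn_integral_insert) (simp_all add: ins)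
    finally show ?thesis .
  qed
  have inner: "(\<integral>\<^sup>+y. h (?v (x(k := y)) - g (?v (x(k := y))) *\<^sub>R axis k 1) \<partial>lborel)
      = (\<integral>\<^sup>+y. h (?v (x(k := y))) \<partial>lborel)" for x
  proof -
    define c where "c = g (?v (x(k := 0)))"
    have gc: "g (?v (x(k := y))) = c" for y
      unfolding c_def by (rule indep) simp
    \<comment> \<open>The translation is written \<open>- c + 1 * y\<close> to match the affine
      substitution rule \<open>nn_integral_real_affine\<close>.\<close>
    have eq: "?v (x(k := y)) - g (?v (x(k := y))) *\<^sub>R axis k 1 = ?v (x(k := - c + 1 * y))" for y
      unfolding gc by (simp add: vec_eq_iff axis_def)
    have m: "(\<lambda>y. ?v (x(k := y))) \<in> borel \<rightarrow>\<^sub>M borel"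
      by (rule borel_measurable_vecI) (simp add: fun_upd_def)
    define r where "r y = h (?v (x(k := y)))" for y
    have "r \<in> borel_measurable borel"
      unfolding r_def using measurable_compose[OF m h] .
    then have "(\<integral>\<^sup>+y. r y \<partial>lborel) = (\<integral>\<^sup>+y. r (- c + 1 * y) \<partial>lborel)"
      using nn_integral_real_affine[of r 1 "- c"] by simp
    then show ?thesis
      unfolding eq r_def by (rule sym)
  qed
  show ?thesis
    by (subst (1 2) split) (simp_all only: inner, simp_all)
qed

text \<open>The converse of a finite acyclic relation is well-founded, so every nonempty
  \<open>A\<close> has a minimal element for it. This selects the node to peel off in the induction
  on shears.\<close>

lemma ex_childless:
  fixes E :: "('n \<times> 'n) set"
  assumes "acyclic E" "finite E" "A \<noteq> {}"
  obtains k where "k \<in> A" "\<And>j. j \<in> A \<Longrightarrow> k \<notin> pa E j"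
  using finite_acyclic_wf_converse[OF assms(2,1)] assms(3)
  unfolding wf_eq_minimal pa_def by (metis converse_iff ex_in_conv mem_Collect_eq)

text \<open>The shift is built up node by node: a node \<open>k\<close> with no children in
  \<open>A\<close> is sheared first, which leaves every \<open>f j\<close> with \<open>j\<close> in
  \<open>A\<close> unchanged, and the remaining nodes are handled by induction.\<close>

lemma nn_integral_lborel_acyclic_shift:
  fixes f :: "'n::finite \<Rightarrow> real^'n \<Rightarrow> real" and h :: "real^'n \<Rightarrow> ennreal"
  assumes E: "acyclic E"
    and f_pa: "\<And>i x y. (\<forall>j\<in>pa E i. x $ j = y $ j) \<Longrightarrow> f i x = f i y"
    and f[measurable]: "\<And>i. f i \<in> borel_measurable borel"
    and h[measurable]: "h \<in> borel_measurable borel"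
  shows "(\<integral>\<^sup>+x. h (\<chi> i. x $ i - f i x) \<partial>lborel) = (\<integral>\<^sup>+x. h x \<partial>lborel)"
proof -
  \<comment> \<open>\<open>T A\<close> shifts only the coordinates in \<open>A\<close>, so it
    interpolates between the identity (\<open>A\<close> empty) and the full shift
    (\<open>A = UNIV\<close>).\<close>
  define T where "T A x = (\<chi> i. if i \<in> A then x $ i - f i x else x $ i)" for A :: "'n set" and x
  have Tm[measurable]: "T A \<in> borel \<rightarrow>\<^sub>M borel" for A
    unfolding T_def by (rule borel_measurable_vecI) simp
  have "(\<integral>\<^sup>+x. h (T A x) \<partial>lborel) = (\<integral>\<^sup>+x. h x \<partial>lborel)" for A
  proof (induction "card A" arbitrary: A)
    case 0
    then show ?case by (simp add: T_def)
  next
    case (Suc n)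
    then have "A \<noteq> {}" by auto
    then obtain k where k: "k \<in> A" "\<And>j. j \<in> A \<Longrightarrow> k \<notin> pa E j"
      using ex_childless[OF E, of A] by auto
    \<comment> \<open>This covers \<open>j = k\<close> as well, since \<open>k\<close> is not its
      own parent.\<close>
    have fk: "f j (x - c *\<^sub>R axis k 1) = f j x" if "j \<in> A" for j x c
      by (rule f_pa) (use k that in \<open>auto simp: axis_def\<close>)
    have T_eq: "T A x = T (A - {k}) (x - f k x *\<^sub>R axis k 1)" for x
      unfolding T_def vec_eq_iff using k(1) fk by (auto simp: axis_def)
    have "(\<integral>\<^sup>+x. h (T A x) \<partial>lborel) = (\<integral>\<^sup>+x. h (T (A - {k}) x) \<partial>lborel)"
      unfolding T_eq
    proof (rule nn_integral_lborel_shear)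
      fix x y :: "real^'n"
      assume xy: "\<And>j. j \<noteq> k \<Longrightarrow> x $ j = y $ j"
      show "f k x = f k y"
        by (rule f_pa) (use k xy in metis)
    qed simp_all
    also have "\<dots> = (\<integral>\<^sup>+x. h x \<partial>lborel)"
      using Suc k by simp
    finally show ?case .
  qed
  from this[of UNIV] show ?thesis
    by (simp add: T_def)
qed

section \<open>Solving the structural equations along the graph\<close>

text \<open>A change in the noise at \<open>j\<close> reaches only \<open>j\<close> and its
  descendants: if \<open>k\<close> is not reachable from \<open>j\<close>, neither are its parents,
  so well-founded induction along the edges applies.\<close>

lemma acyclic_solution_cong:
  fixes f :: "'n::finite \<Rightarrow> real^'n \<Rightarrow> real"
  assumes E: "acyclic E"
    and f_pa: "\<And>i x y. (\<forall>j\<in>pa E i. x $ j = y $ j) \<Longrightarrow> f i x = f i y"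
    and x: "\<And>i. x $ i = f i x + e $ i" and y: "\<And>i. y $ i = f i y + e' $ i"
    and e: "\<And>i. i \<noteq> j \<Longrightarrow> e $ i = e' $ i"
    and k: "(j, k) \<notin> E\<^sup>*"
  shows "x $ k = y $ k"
proof -
  have "wf E" using E by (simp add: finite_acyclic_wf)
  then show ?thesis using k
  proof (induction k)
    case (less k)
    have "f k x = f k y"
      by (rule f_pa) (use less in \<open>auto simp: pa_def intro: rtrancl_into_rtrancl\<close>)
    moreover have "k \<noteq> j" using less.prems by auto
    ultimately show ?case
      using x[of k] y[of k] e by simp
  qed
qed

text \<open>Makes the inverse of \<open>x \<mapsto> x - f x\<close> an explicit finite iterate, hence measurable.\<close>

lemma acyclic_iterate_forgets:
  fixes f :: "'n::finite \<Rightarrow> real^'n \<Rightarrow> real"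
  assumes E: "acyclic E"
    and f_pa: "\<And>i x y. (\<forall>j\<in>pa E i. x $ j = y $ j) \<Longrightarrow> f i x = f i y"
  defines "S \<equiv> \<lambda>e x. (\<chi> i. f i x + e $ i)"
  obtains N where "\<And>e x y. (S e ^^ N) x = (S e ^^ N) y"
proof -
  have "wf E" using E by (simp add: finite_acyclic_wf)
  \<comment> \<open>The claim is made for all \<open>n\<close> beyond a threshold because the
    parents of a node settle at different times.\<close>
  then have "\<exists>N. \<forall>n\<ge>N. \<forall>e x y. (S e ^^ n) x $ k = (S e ^^ n) y $ k" for k
  proof (induction k)
    case (less k)
    then have "\<forall>j\<in>pa E k. \<exists>N. \<forall>n\<ge>N. \<forall>e x y. (S e ^^ n) x $ j = (S e ^^ n) y $ j"
      by (simp add: pa_def)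
    then obtain N where "\<forall>j\<in>pa E k. \<forall>n\<ge>N j. \<forall>e x y. (S e ^^ n) x $ j = (S e ^^ n) y $ j"
      by (rule bchoice[THEN exE])
    then have N: "(S e ^^ n) x $ j = (S e ^^ n) y $ j" if "j \<in> pa E k" "n \<ge> N j" for j n e x y
      using that by blast
    \<comment> \<open>A node settles one step after its parents. The maximum runs over all nodes, so
      it is taken over a nonempty set even when \<open>k\<close> has no parents.\<close>
    have "(S e ^^ n) x $ k = (S e ^^ n) y $ k" if n: "n \<ge> Suc (Max (range N))" for n e x y
    proof -
      from n obtain m where m: "n = Suc m" "m \<ge> Max (range N)"
        by (metis Suc_le_D Suc_le_mono)
      have "N j \<le> m" for j
        using m by (meson Max_ge finite finite_imageI rangeI order_trans)
      then have "f k ((S e ^^ m) x) = f k ((S e ^^ m) y)"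
        by (intro f_pa) (simp add: N)
      then show ?thesis
        by (simp add: m S_def)
    qed
    then show ?case by blast
  qed
  then have "\<forall>k. \<exists>N. \<forall>n\<ge>N. \<forall>e x y. (S e ^^ n) x $ k = (S e ^^ n) y $ k"
    by blast
  then obtain N where N: "\<forall>k. \<forall>n\<ge>N k. \<forall>e x y. (S e ^^ n) x $ k = (S e ^^ n) y $ k"
    by (rule choice[THEN exE])
  have "(S e ^^ Max (range N)) x = (S e ^^ Max (range N)) y" for e x y
    by (simp add: vec_eq_iff N)
  then show thesis by (rule that)
qed

text \<open>Once the \<open>N\<close>-fold iterate forgets its starting point, it is a fixed point
  of \<open>S e\<close>. Any solution is itself a fixed point, hence equal to that iterate.\<close>

lemma acyclic_shift_inverse:
  fixes f :: "'n::finite \<Rightarrow> real^'n \<Rightarrow> real"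
  assumes E: "acyclic E"
    and f_pa: "\<And>i x y. (\<forall>j\<in>pa E i. x $ j = y $ j) \<Longrightarrow> f i x = f i y"
    and f[measurable]: "\<And>i. f i \<in> borel_measurable borel"
  obtains U :: "real^'n \<Rightarrow> real^'n" where
    "U \<in> borel_measurable borel"
    "\<And>e i. U e $ i = f i (U e) + e $ i"
    "\<And>x e. (\<And>i. x $ i = f i x + e $ i) \<Longrightarrow> U e = x"
proof -
  define S where "S = (\<lambda>e x. (\<chi> i. f i x + e $ i))"
  obtain N where N: "\<And>e x y. (S e ^^ N) x = (S e ^^ N) y"
    using acyclic_iterate_forgets[where f=f, OF E f_pa] unfolding S_def by blast
  define U where "U e = (S e ^^ N) 0" for e
  have S_m: "(\<lambda>e. (S e ^^ n) 0) \<in> borel_measurable borel" for n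
  proof (induction n)
    case (Suc n)
    note Suc[measurable]
    show ?case
      unfolding funpow.simps comp_def by (subst S_def) (rule borel_measurable_vecI, simp)
  qed simp
  have "U \<in> borel_measurable borel"
    unfolding U_def by (rule S_m)
  moreover have "U e $ i = f i (U e) + e $ i" for e i
  proof -
    \<comment> \<open>The extra application is moved inside, where it only changes the starting
      point from \<open>0\<close> to \<open>S e 0\<close>.\<close>
    have "S e (U e) = (S e ^^ N) (S e 0)"
      by (simp add: U_def funpow_swap1)
    also have "\<dots> = U e" unfolding U_def by (rule N)
    finally show ?thesis by (simp add: S_def vec_eq_iff)
  qed
  moreover have "U e = x" if x: "\<And>i. x $ i = f i x + e $ i" for x e
  proof -
    have "S e x = x" by (simp add: S_def vec_eq_iff flip: x)
    then have "(S e ^^ n) x = x" for n by (induction n) auto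
    then show ?thesis unfolding U_def by (metis N)
  qed
  ultimately show thesis by (rule that)
qed

section \<open>Joint densities of the noise and of the observed vector\<close>

text \<open>Boxes form an intersection-stable generator, so comparing the two measures on them
  suffices. There independence factors the probability, and the one-dimensional integrals recombine
  over the product measure.\<close>

lemma (in prob_space) distributed_indep_vec:
  fixes \<epsilon> :: "'n::finite \<Rightarrow> 'a \<Rightarrow> real" and g :: "'n \<Rightarrow> real \<Rightarrow> ennreal"
  assumes indep: "indep_vars (\<lambda>_. borel) \<epsilon> UNIV"
    and dist: "\<And>i. distributed M lborel (\<epsilon> i) (g i)"
  shows "distributed M lborel (\<lambda>\<omega>. \<chi> i. \<epsilon> i \<omega>) (\<lambda>x. \<Prod>i\<in>UNIV. g i (x $ i))"
proof -
  interpret P: product_sigma_finite "\<lambda>i::'n. lborel :: real measure"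
    by (rule product_sigma_finite_lborel)
  have [measurable]: "\<epsilon> i \<in> borel_measurable M" "g i \<in> borel_measurable borel" for i
    using dist[of i] by (auto simp: distributed_def)
  have V[measurable]: "(\<lambda>\<omega>. \<chi> i. \<epsilon> i \<omega>) \<in> borel_measurable M"
    by (rule borel_measurable_vecI) simp
  let ?D = "distr M lborel (\<lambda>\<omega>. \<chi> i. \<epsilon> i \<omega>)"
  let ?G = "density lborel (\<lambda>x::real^'n. \<Prod>i\<in>UNIV. g i (x $ i))"
  let ?B = "range (\<lambda>(a, b). box a b :: (real^'n) set)"
  let ?A = "\<lambda>n::nat. box (- (real n *\<^sub>R One)) (real n *\<^sub>R One) :: (real^'n) set"
  have "?D = ?G"
  proof (rule measure_eqI_generator_eq)
    show "Int_stable ?B" by (auto simp: Int_stable_def box_Int_box)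
    show "sets ?D = sigma_sets UNIV ?B" "sets ?G = sigma_sets UNIV ?B"
      by (simp_all add: borel_eq_box)
    show "range ?A \<subseteq> ?B" "(\<Union>n. ?A n) = UNIV"
      unfolding UN_box_eq_UNIV by auto
    show "emeasure ?D (?A n) \<noteq> \<infinity>" for n
      by (simp add: emeasure_distr)
    show "?B \<subseteq> Pow UNIV" by simp
    fix B assume "B \<in> ?B"
    then obtain a b where B: "B = box a b" by auto
    have "(\<lambda>\<omega>. \<chi> i. \<epsilon> i \<omega>) -` B \<inter> space M = (\<Inter>i\<in>UNIV. \<epsilon> i -` {a $ i<..<b $ i} \<inter> space M)"
      by (auto simp: B mem_box_cart)
    then have "emeasure ?D B = prob (\<Inter>i\<in>UNIV. \<epsilon> i -` {a $ i<..<b $ i} \<inter> space M)"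
      by (simp add: emeasure_distr B emeasure_eq_measure)
    also have "\<dots> = ennreal (\<Prod>i\<in>UNIV. prob (\<epsilon> i -` {a $ i<..<b $ i} \<inter> space M))"
      by (subst indep_varsD_finite[OF indep]) simp_all
    also have "\<dots> = (\<Prod>i\<in>UNIV. emeasure M (\<epsilon> i -` {a $ i<..<b $ i} \<inter> space M))"
      by (simp add: prod_ennreal emeasure_eq_measure)
    also have "\<dots> = (\<Prod>i\<in>UNIV. \<integral>\<^sup>+t. g i t * indicator {a $ i<..<b $ i} t \<partial>lborel)"
      by (intro prod.cong refl distributed_emeasure[OF dist]) simp
    also have "\<dots> = (\<integral>\<^sup>+x. (\<Prod>i\<in>UNIV. g i (x i) * indicator {a $ i<..<b $ i} (x i))
        \<partial>PiM UNIV (\<lambda>i::'n. lborel))"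
      by (rule P.product_nn_integral_prod[symmetric]) simp_all
    also have "\<dots> = (\<integral>\<^sup>+x. (\<Prod>i\<in>UNIV. g i (x $ i) * indicator {a $ i<..<b $ i} (x $ i)) \<partial>lborel)"
      by (subst lborel_vec_eq_distr_PiM, subst nn_integral_distr[OF borel_measurable_vec_PiM]) simp_all
    also have "\<dots> = (\<integral>\<^sup>+x. (\<Prod>i\<in>UNIV. g i (x $ i)) * indicator B x \<partial>lborel)"
    proof (intro nn_integral_cong)
      fix x
      have "(\<Prod>i\<in>UNIV. indicator {a $ i<..<b $ i} (x $ i)) = (indicator B x :: ennreal)"
        by (auto simp: B mem_box_cart indicator_def)
      then show "(\<Prod>i\<in>UNIV. g i (x $ i) * indicator {a $ i<..<b $ i} (x $ i))
          = (\<Prod>i\<in>UNIV. g i (x $ i)) * indicator B x"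
        by (simp add: prod.distrib)
    qed
    also have "\<dots> = emeasure ?G B"
      by (simp add: emeasure_density B)
    finally show "emeasure ?D B = emeasure ?G B" .
  qed
  then show ?thesis by (simp add: distributed_def)
qed

text \<open>\<open>X\<close> is the image of \<open>V\<close> under the inverse \<open>U\<close> of
  the shift. Since the shift preserves Lebesgue measure, the change of variables has no Jacobian
  factor.\<close>

lemma distributed_additive_noise:
  fixes f :: "'n::finite \<Rightarrow> real^'n \<Rightarrow> real" and X V :: "'w \<Rightarrow> real^'n"
  assumes E: "acyclic E"
    and f_pa: "\<And>i x y. (\<forall>j\<in>pa E i. x $ j = y $ j) \<Longrightarrow> f i x = f i y"
    and f[measurable]: "\<And>i. f i \<in> borel_measurable borel"
    and X: "\<And>\<omega> i. \<omega> \<in> space M \<Longrightarrow> X \<omega> $ i = f i (X \<omega>) + V \<omega> $ i"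
    and V: "distributed M lborel V \<phi>"
  shows "distributed M lborel X (\<lambda>x. \<phi> (\<chi> i. x $ i - f i x))"
proof -
  have [measurable]: "\<phi> \<in> borel_measurable borel" "V \<in> borel_measurable M"
    using V by (auto simp: distributed_def)
  let ?T = "\<lambda>x. \<chi> i. x $ i - f i x"
  have [measurable]: "?T \<in> borel \<rightarrow>\<^sub>M borel"
    by (rule borel_measurable_vecI) simp
  obtain U where U[measurable]: "U \<in> borel_measurable borel"
    and "\<And>e i. U e $ i = f i (U e) + e $ i"
    and U_eq: "\<And>x e. (\<And>i. x $ i = f i x + e $ i) \<Longrightarrow> U e = x"
    using acyclic_shift_inverse[where f=f, OF E f_pa f] by blast
  have UT: "U (?T x) = x" for x by (rule U_eq) simp
  have XU: "X \<omega> = U (V \<omega>)" if "\<omega> \<in> space M" for \<omega>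
    using U_eq[of "X \<omega>" "V \<omega>"] X[OF that] by simp
  have X_m[measurable]: "X \<in> borel_measurable M"
    using XU by (subst measurable_cong[of _ _ "\<lambda>\<omega>. U (V \<omega>)"]) auto
  have "distr M lborel X = density lborel (\<lambda>x. \<phi> (?T x))"
  proof (rule measure_eqI)
    fix B assume "B \<in> sets (distr M lborel X)"
    then have B[measurable]: "B \<in> sets borel" by simp
    have "emeasure (distr M lborel X) B = emeasure M (V -` (U -` B) \<inter> space M)"
      by (subst emeasure_distr) (auto intro!: arg_cong2[where f=emeasure] simp: XU)
    also have "\<dots> = (\<integral>\<^sup>+e. \<phi> e * indicator (U -` B) e \<partial>lborel)"
      using measurable_sets[OF U B] by (intro distributed_emeasure[OF V]) simp
    also have "\<dots> = (\<integral>\<^sup>+x. \<phi> (?T x) * indicator (U -` B) (?T x) \<partial>lborel)"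
      using measurable_sets[OF U B]
      by (intro nn_integral_lborel_acyclic_shift[where f=f, OF E f_pa, symmetric]) simp_all
    also have "\<dots> = (\<integral>\<^sup>+x. \<phi> (?T x) * indicator B x \<partial>lborel)"
      by (simp add: indicator_def UT)
    also have "\<dots> = emeasure (density lborel (\<lambda>x. \<phi> (?T x))) B"
      by (simp add: emeasure_density)
    finally show "emeasure (distr M lborel X) B = emeasure (density lborel (\<lambda>x. \<phi> (?T x))) B" .
  qed simp
  then show ?thesis by (simp add: distributed_def)
qed

text \<open>The set of disagreement is open, and a nonempty open set is not Lebesgue-null. This
  upgrades almost-everywhere uniqueness of densities to pointwise equality, as differentiating
  \<open>ln p\<close> demands.\<close>

lemma AE_lborel_eq_imp_eq:
  fixes p q :: "'a::euclidean_space \<Rightarrow> 'b::t2_space"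
  assumes p: "continuous_on UNIV p" and q: "continuous_on UNIV q"
    and ae: "AE x in lborel. p x = q x"
  shows "p x = q x"
proof (rule ccontr)
  assume x: "p x \<noteq> q x"
  have "open {x. p x \<noteq> q x}"
    using p q by (rule open_Collect_neq)
  moreover have "{x. p x \<noteq> q x} \<in> null_sets lborel"
    using ae \<open>open _\<close> by (subst (asm) AE_iff_null) simp_all
  ultimately show False
    using x open_not_negligible[of "{x. p x \<noteq> q x}"]
    by (auto simp: negligible_iff_null_sets intro: null_sets_completionI)
qed

section \<open>Partial derivatives and the Hessian diagonal of the log density\<close>

lemma has_derivative_imp_axis_DERIV:
  fixes g :: "real^'n::finite \<Rightarrow> real"
  assumes "(g has_derivative D) (at x)"
  shows "((\<lambda>t. g (x + t *\<^sub>R axis i 1)) has_real_derivative D (axis i 1)) (at 0)"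
proof -
  have "((\<lambda>t. x + t *\<^sub>R axis i 1) has_derivative (\<lambda>t. t *\<^sub>R axis i 1)) (at 0)"
    by (auto intro!: derivative_eq_intros)
  then have "((\<lambda>t. g (x + t *\<^sub>R axis i 1)) has_derivative (\<lambda>t. D (t *\<^sub>R axis i 1))) (at 0)"
    using assms by (auto intro: has_derivative_compose)
  moreover have "D (t *\<^sub>R axis i 1) = D (axis i 1) * t" for t
    using assms by (simp add: has_derivative_linear linear_scale)
  ultimately show ?thesis
    by (simp add: has_field_derivative_def)
qed

text \<open>The partials are the Frechet derivatives evaluated on the axis vector:
  \<open>G x\<close> once, \<open>H x\<close> twice. As \<open>deriv\<close> is meaningful only
  where a derivative exists, existence is recorded along with the value.\<close>

lemma C2_partial:
  assumes "C2 g"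
  shows C2_DERIV_partial:
      "\<And>x. ((\<lambda>t. g (x + t *\<^sub>R axis i 1)) has_real_derivative partial i g x) (at 0)"
    and C2_DERIV_partial_partial:
      "\<And>x. ((\<lambda>t. partial i g (x + t *\<^sub>R axis i 1)) has_real_derivative partial i (partial i g) x) (at 0)"
    and C2_imp_continuous: "continuous_on UNIV g"
    and C2_imp_continuous_partial_partial: "continuous_on UNIV (partial i (partial i g))"
proof -
  obtain G H where G: "\<And>x. (g has_derivative blinfun_apply (G x)) (at x)"
    and H: "\<And>x. (G has_derivative blinfun_apply (H x)) (at x)" and H_cont: "continuous_on UNIV H"
    using assms unfolding C2_def by blast
  let ?a = "axis i 1 :: real^'a"
  have g_d: "((\<lambda>t. g (x + t *\<^sub>R ?a)) has_real_derivative G x ?a) (at 0)" for x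
    by (rule has_derivative_imp_axis_DERIV[OF G])
  then have pg: "partial i g = (\<lambda>x. G x ?a)"
    by (auto simp: partial_def DERIV_imp_deriv)
  have "((\<lambda>x. G x ?a) has_derivative (\<lambda>h. H x h ?a)) (at x)" for x
    by (rule bounded_linear.has_derivative[OF blinfun.bounded_linear_left H])
  then have p_d: "((\<lambda>t. partial i g (x + t *\<^sub>R ?a)) has_real_derivative H x ?a ?a) (at 0)" for x
    unfolding pg by (rule has_derivative_imp_axis_DERIV)
  then have pp: "partial i (partial i g) = (\<lambda>x. H x ?a ?a)"
    by (auto simp: partial_def[of i "partial i g"] DERIV_imp_deriv)
  show "((\<lambda>t. g (x + t *\<^sub>R ?a)) has_real_derivative partial i g x) (at 0)" for x
    using g_d by (simp add: pg)
  show "((\<lambda>t. partial i g (x + t *\<^sub>R ?a)) has_real_derivative partial i (partial i g) x) (at 0)" for x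
    using p_d by (simp add: pp)
  show "continuous_on UNIV g"
    using G by (auto intro!: has_derivative_continuous_on intro: has_derivative_at_withinI)
  show "continuous_on UNIV (partial i (partial i g))"
    unfolding pp by (intro continuous_intros H_cont)
qed

text \<open>Moving both points equally along an axis preserves their agreement on \<open>P\<close>.
  Applied twice, this shows that second partials of \<open>f j\<close> still depend only on the
  parents of \<open>j\<close>.\<close>

lemma partial_cong_on:
  assumes g: "\<And>x y. (\<forall>j\<in>P. x $ j = y $ j) \<Longrightarrow> g x = g y" and xy: "\<forall>j\<in>P. x $ j = y $ j"
  shows "partial i g x = partial i g y"
proof -
  have "g (x + t *\<^sub>R axis i 1) = g (y + t *\<^sub>R axis i 1)" for t
    by (rule g) (use xy in auto)
  then show ?thesis by (simp add: partial_def)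
qed

lemma partial_eq_0:
  assumes g: "\<And>x y. (\<forall>j\<in>P. x $ j = y $ j) \<Longrightarrow> g x = g y" and i: "i \<notin> P"
  shows "partial i g x = 0"
proof -
  have "g (x + t *\<^sub>R axis i 1) = g x" for t
    by (rule g) (use i in \<open>auto simp: axis_def\<close>)
  then show ?thesis by (simp add: partial_def)
qed

text \<open>The logarithm turns the product into constants minus squared residuals over
  \<open>2 * \<sigma>\<^sup>2\<close>; the product rule, applied to residual times its derivative,
  yields the two terms of each summand.\<close>

lemma partial_ln_normal_density_residuals:
  fixes f :: "'n::finite \<Rightarrow> real^'n \<Rightarrow> real"
  assumes \<sigma>: "\<sigma> > 0" and f: "\<And>j. C2 (f j)"
  defines "L \<equiv> \<lambda>x. ln (\<Prod>j\<in>UNIV. normal_density 0 \<sigma> (x $ j - f j x))"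
  shows "partial i (partial i L) x =
    (\<Sum>j\<in>UNIV. (x $ j - f j x) * partial i (partial i (f j)) x - (axis i 1 $ j - partial i (f j) x)\<^sup>2) / \<sigma>\<^sup>2"
proof -
  let ?a = "axis i 1 :: real^'n"
  have L: "L x = (\<Sum>j\<in>UNIV. ln (1 / sqrt (2 * pi * \<sigma>\<^sup>2)) - (x $ j - f j x)\<^sup>2 / (2 * \<sigma>\<^sup>2))" for x
  proof -
    have "L x = (\<Sum>j\<in>UNIV. ln (normal_density 0 \<sigma> (x $ j - f j x)))"
      unfolding L_def by (rule ln_prod) (use normal_density_pos[OF \<sigma>] in \<open>simp_all add: less_imp_neq[THEN not_sym]\<close>)
    also have "\<dots> = (\<Sum>j\<in>UNIV. ln (1 / sqrt (2 * pi * \<sigma>\<^sup>2)) - (x $ j - f j x)\<^sup>2 / (2 * \<sigma>\<^sup>2))"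
      using \<sigma> unfolding normal_density_def by (intro sum.cong refl, subst ln_mult) simp_all
    finally show ?thesis .
  qed
  have r: "((\<lambda>t. (x + t *\<^sub>R ?a) $ j - f j (x + t *\<^sub>R ?a)) has_real_derivative ?a $ j - partial i (f j) x) (at 0)"
    for x j
  proof (rule DERIV_diff[OF _ C2_DERIV_partial[OF f]])
    show "((\<lambda>t. (x + t *\<^sub>R ?a) $ j) has_real_derivative ?a $ j) (at 0)"
      by (auto intro!: derivative_eq_intros)
  qed
  have sq: "((\<lambda>t. c - (u t)\<^sup>2 / (2 * \<sigma>\<^sup>2)) has_real_derivative - u 0 * u' / \<sigma>\<^sup>2) (at 0)"
    if "(u has_real_derivative u') (at 0)" for c u u'
    using that \<sigma> by (auto intro!: derivative_eq_intros simp: field_simps)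
  \<comment> \<open>Here \<open>u\<close> is the residual along the coordinate line,
    \<open>c\<close> the Kronecker delta and \<open>v\<close> the first partial of
    \<open>f j\<close>; then \<open>u' = c - v 0\<close>, which produces the square.\<close>
  have mult: "((\<lambda>t. - u t * (c - v t) / \<sigma>\<^sup>2) has_real_derivative (u 0 * v' - u' * (c - v 0)) / \<sigma>\<^sup>2) (at 0)"
    if "(u has_real_derivative u') (at 0)" "(v has_real_derivative v') (at 0)" for c u u' v v'
    using that \<sigma> by (auto intro!: derivative_eq_intros simp: field_simps)
  have "((\<lambda>t. L (x + t *\<^sub>R ?a)) has_real_derivative
      (\<Sum>j\<in>UNIV. - (x $ j - f j x) * (?a $ j - partial i (f j) x) / \<sigma>\<^sup>2)) (at 0)" for x
    unfolding L using sq[OF r[of x]] by (intro DERIV_sum) simp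
  then have pL: "partial i L = (\<lambda>x. \<Sum>j\<in>UNIV. - (x $ j - f j x) * (?a $ j - partial i (f j) x) / \<sigma>\<^sup>2)"
    by (auto simp: partial_def[of i L] DERIV_imp_deriv)
  have "((\<lambda>t. partial i L (x + t *\<^sub>R ?a)) has_real_derivative
      (\<Sum>j\<in>UNIV. ((x $ j - f j x) * partial i (partial i (f j)) x - (?a $ j - partial i (f j) x)\<^sup>2) / \<sigma>\<^sup>2)) (at 0)"
    unfolding pL using mult[OF r[of x] C2_DERIV_partial_partial[OF f, where x=x and i=i]]
    by (intro DERIV_sum) (simp add: power2_eq_square)
  then show ?thesis
    by (simp add: partial_def[of i "partial i L"] DERIV_imp_deriv sum_divide_distrib)
qed

section \<open>Independence of a noise term from the parents of its node\<close>

text \<open>The parents of \<open>j\<close> are not descendants of \<open>j\<close>, so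
  \<open>h (X \<omega>)\<close> is a measurable function of the noises other than
  \<open>\<epsilon> j\<close>. Independence then factors the expectation.\<close>

lemma (in prob_space) noise_times_parent_function:
  fixes f :: "'n::finite \<Rightarrow> real^'n \<Rightarrow> real" and X :: "'a \<Rightarrow> real^'n" and h :: "real^'n \<Rightarrow> real"
  assumes E: "acyclic E"
    and f_pa: "\<And>i x y. (\<forall>j\<in>pa E i. x $ j = y $ j) \<Longrightarrow> f i x = f i y"
    and f: "\<And>i. f i \<in> borel_measurable borel"
    and X: "\<And>\<omega> i. \<omega> \<in> space M \<Longrightarrow> X \<omega> $ i = f i (X \<omega>) + \<epsilon> i \<omega>"
    and indep: "indep_vars (\<lambda>_. borel) \<epsilon> UNIV"
    and h_pa: "\<And>x y. (\<forall>k\<in>pa E j. x $ k = y $ k) \<Longrightarrow> h x = h y"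
    and h: "h \<in> borel_measurable borel"
    and int_eps: "integrable M (\<epsilon> j)" and int_h: "integrable M (\<lambda>\<omega>. h (X \<omega>))"
  shows "integrable M (\<lambda>\<omega>. \<epsilon> j \<omega> * h (X \<omega>))" (is ?int)
    and "expectation (\<lambda>\<omega>. \<epsilon> j \<omega> * h (X \<omega>)) = expectation (\<epsilon> j) * expectation (\<lambda>\<omega>. h (X \<omega>))" (is ?eq)
proof -
  note h[measurable]
  obtain U where U[measurable]: "U \<in> borel_measurable borel"
    and U_sol: "\<And>e i. U e $ i = f i (U e) + e $ i"
    and "\<And>x e. (\<And>i. x $ i = f i x + e $ i) \<Longrightarrow> U e = x"
    using acyclic_shift_inverse[where f=f, OF E f_pa f] by blast
  \<comment> \<open>\<open>W\<close> solves the equations with noise \<open>0\<close> at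
    \<open>j\<close>; the parents of \<open>j\<close> take the same values as under the true
    noise.\<close>
  define W where "W z = h (U (\<chi> i. if i = j then 0 else z i))" for z :: "'n \<Rightarrow> real"
  define A where "A = UNIV - {j}"
  have hX: "h (X \<omega>) = W (restrict (\<lambda>i. \<epsilon> i \<omega>) A)" if \<omega>: "\<omega> \<in> space M" for \<omega>
  proof -
    let ?e = "\<chi> i. if i = j then 0 else restrict (\<lambda>i. \<epsilon> i \<omega>) A i"
    have "X \<omega> $ k = U ?e $ k" if k: "k \<in> pa E j" for k
    proof (rule acyclic_solution_cong[where f=f and e="\<chi> i. \<epsilon> i \<omega>" and e'="?e" and j=j, OF E f_pa])
      \<comment> \<open>A path from \<open>j\<close> to its parent \<open>k\<close> would close a
        cycle with the edge from \<open>k\<close> to \<open>j\<close>.\<close>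
      show "(j, k) \<notin> E\<^sup>*"
        using E k by (auto simp: acyclic_def pa_def dest: rtrancl_into_trancl1)
    qed (use \<omega> X U_sol[of ?e] in \<open>auto simp: A_def\<close>)
    then show ?thesis
      unfolding W_def by (intro h_pa) simp
  qed
  have Wm: "W \<in> borel_measurable (PiM A (\<lambda>_. borel))"
  proof -
    have "(\<lambda>z. \<chi> i. if i = j then 0 else z i) \<in> PiM A (\<lambda>_. borel :: real measure) \<rightarrow>\<^sub>M (borel :: (real^'n) measure)"
    proof (rule borel_measurable_vecI)
      fix i
      show "(\<lambda>z. (\<chi> i. if i = j then 0 else z i) $ i) \<in> borel_measurable (PiM A (\<lambda>_. borel :: real measure))"
        by (cases "i = j") (simp_all add: A_def)
    qed
    then show ?thesis unfolding W_def by measurable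
  qed
  have "indep_var borel ((\<lambda>z. z j) \<circ> (\<lambda>\<omega>. restrict (\<lambda>i. \<epsilon> i \<omega>) {j}))
      borel (W \<circ> (\<lambda>\<omega>. restrict (\<lambda>i. \<epsilon> i \<omega>) A))"
    by (rule indep_var_compose[OF indep_var_restrict[OF indep] _ Wm]) (auto simp: A_def)
  then have ind: "indep_var borel (\<epsilon> j) borel (\<lambda>\<omega>. W (restrict (\<lambda>i. \<epsilon> i \<omega>) A))"
    by (simp add: comp_def)
  have int_W: "integrable M (\<lambda>\<omega>. W (restrict (\<lambda>i. \<epsilon> i \<omega>) A))"
    using int_h by (rule Bochner_Integration.integrable_cong[THEN iffD1, rotated 2]) (simp_all add: hX)
  show ?int
    using indep_var_integrable[OF ind int_eps int_W]
    by (rule Bochner_Integration.integrable_cong[THEN iffD1, rotated 2]) (simp_all add: hX)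
  have "expectation (\<lambda>\<omega>. \<epsilon> j \<omega> * h (X \<omega>)) = expectation (\<lambda>\<omega>. \<epsilon> j \<omega> * W (restrict (\<lambda>i. \<epsilon> i \<omega>) A))"
    by (rule Bochner_Integration.integral_cong) (simp_all add: hX)
  also have "\<dots> = expectation (\<epsilon> j) * expectation (\<lambda>\<omega>. W (restrict (\<lambda>i. \<epsilon> i \<omega>) A))"
    by (rule indep_var_lebesgue_integral[OF ind int_eps int_W])
  also have "expectation (\<lambda>\<omega>. W (restrict (\<lambda>i. \<epsilon> i \<omega>) A)) = expectation (\<lambda>\<omega>. h (X \<omega>))"
    by (rule Bochner_Integration.integral_cong) (simp_all add: hX)
  finally show ?eq .
qed

section \<open>The diagonal of the SJIM and the characterisation of sinks\<close>

theorem theorem3p1: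
  fixes M :: "'w measure"
    and E :: "('n::finite \<times> 'n) set"
    and f :: "'n \<Rightarrow> real^'n \<Rightarrow> real"
    and \<epsilon> :: "'n \<Rightarrow> 'w \<Rightarrow> real"
    and X :: "'w \<Rightarrow> real^'n"
    and p :: "real^'n \<Rightarrow> real"
    and \<sigma> :: real
  assumes prob: "prob_space M"
    and dag: "acyclic E"
    and f_pa: "\<And>i x y. (\<forall>j\<in>pa E i. x $ j = y $ j) \<Longrightarrow> f i x = f i y"
    and f_C2: "\<And>i. C2 (f i)"
    and sigma_pos: "\<sigma> > 0"
    and eps_indep: "prob_space.indep_vars M (\<lambda>_. borel) \<epsilon> UNIV"
    and eps_normal: "\<And>i. distributed M lborel (\<epsilon> i) (\<lambda>t. ennreal (normal_density 0 \<sigma> t))"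
    and anm: "\<And>\<omega> i. \<omega> \<in> space M \<Longrightarrow> X \<omega> $ i = f i (X \<omega>) + \<epsilon> i \<omega>"
    and density: "distributed M lborel X (\<lambda>x. ennreal (p x))"
    and p_cont: "continuous_on UNIV p"
    and int_hess: "\<And>i k. integrable M (\<lambda>\<omega>. partial i (partial k (\<lambda>y. ln (p y))) (X \<omega>))"
    and int_grad: "\<And>i j. integrable M (\<lambda>\<omega>. (partial i (f j) (X \<omega>))\<^sup>2)"
    and int_hess_f: "\<And>i j. integrable M (\<lambda>\<omega>. partial i (partial i (f j)) (X \<omega>))"
  shows "(\<forall>i. SJIM M X p i i
            = 1 / \<sigma>\<^sup>2 + 1 / \<sigma>\<^sup>2 * (\<Sum>j\<in>ch E i. \<integral>\<omega>. (partial i (f j) (X \<omega>))\<^sup>2 \<partial>M))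
       \<and> ((\<forall>(j, i)\<in>E. (\<integral>\<omega>. (partial j (f i) (X \<omega>))\<^sup>2 \<partial>M) > 0) \<longrightarrow>
           (\<forall>l. (SJIM M X p l l = (MIN i. SJIM M X p i i) \<and> SJIM M X p l l = 1 / \<sigma>\<^sup>2)
                  \<longleftrightarrow> ch E l = {}))"
proof -
  interpret prob_space M by (rule prob)
  have f_m[measurable]: "f j \<in> borel_measurable borel" for j
    using C2_imp_continuous[OF f_C2] by (rule borel_measurable_continuous_onI)
  define q where "q x = (\<Prod>j\<in>UNIV. normal_density 0 \<sigma> (x $ j - f j x))" for x
  have q_pos: "q x > 0" for x
    unfolding q_def using normal_density_pos[OF sigma_pos] by (simp add: prod_pos)
  have "distributed M lborel (\<lambda>\<omega>. \<chi> i. \<epsilon> i \<omega>) (\<lambda>e. \<Prod>i\<in>UNIV. ennreal (normal_density 0 \<sigma> (e $ i)))"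
    by (rule distributed_indep_vec[OF eps_indep eps_normal])
  from distributed_additive_noise[where f=f and X=X, OF dag f_pa f_m _ this]
  have "distributed M lborel X (\<lambda>x. ennreal (q x))"
    by (simp add: anm[symmetric] q_def prod_ennreal)
  from distributed_unique[OF density this]
  \<comment> \<open>\<open>ennreal\<close> truncates negative values, so uniqueness of densities at
    first determines only \<open>max 0 (p x)\<close>. Strict positivity of \<open>q\<close> later
    removes the truncation.\<close>
  have "AE x in lborel. max 0 (p x) = q x"
  proof eventually_elim
    case (elim x)
    have "ennreal (max 0 (p x)) = ennreal (p x)"
      by (cases "0 \<le> p x") (simp_all add: max_def ennreal_neg)
    then have "ennreal (max 0 (p x)) = ennreal (q x)"
      using elim by simp
    then show ?case
      using q_pos[of x] by (subst (asm) ennreal_inj) simp_all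
  qed
  moreover have "continuous_on UNIV (\<lambda>x. max 0 (p x))"
    by (intro continuous_intros p_cont)
  moreover have "continuous_on UNIV q"
    unfolding q_def normal_density_def using sigma_pos
    by (auto intro!: continuous_intros C2_imp_continuous[OF f_C2])
  ultimately have pq: "max 0 (p x) = q x" for x
    by (intro AE_lborel_eq_imp_eq[where p="\<lambda>x. max 0 (p x)" and q=q])
  have "p = q"
  proof
    show "p x = q x" for x
      using pq[of x] q_pos[of x] by (simp add: max_def split: if_splits)
  qed
  then have pp: "partial i (partial i (\<lambda>y. ln (p y))) x =
      (\<Sum>j\<in>UNIV. (x $ j - f j x) * partial i (partial i (f j)) x - (axis i 1 $ j - partial i (f j) x)\<^sup>2) / \<sigma>\<^sup>2"
    for i x
    using partial_ln_normal_density_residuals[where f=f and i=i and x=x, OF sigma_pos f_C2] by (simp add: q_def)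

  have eps_int: "integrable M (\<epsilon> j)" for j
    using distributed_integrable_var[OF eps_normal[of j]] integrable_normal_moment_nz_1[OF sigma_pos]
    by (simp add: normal_density_nonneg)
  have eps_0: "expectation (\<epsilon> j) = 0" for j
    by (rule normal_distributed_expectation[OF sigma_pos eps_normal])
  have hess_m: "partial i (partial i (f j)) \<in> borel_measurable borel" for i j
    using C2_imp_continuous_partial_partial[OF f_C2] by (rule borel_measurable_continuous_onI)
  have hess_pa: "partial i (partial i (f j)) x = partial i (partial i (f j)) y"
    if "\<forall>k\<in>pa E j. x $ k = y $ k" for i j x y
    by (rule partial_cong_on[OF partial_cong_on[OF f_pa] that])
  have noise_int: "integrable M (\<lambda>\<omega>. \<epsilon> j \<omega> * partial i (partial i (f j)) (X \<omega>))"
    and noise_0: "expectation (\<lambda>\<omega>. \<epsilon> j \<omega> * partial i (partial i (f j)) (X \<omega>)) = 0" for i j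
  proof -
    note noise = noise_times_parent_function[where f=f and X=X and \<epsilon>=\<epsilon> and j=j
        and h="partial i (partial i (f j))",
        OF dag f_pa f_m anm eps_indep hess_pa hess_m eps_int int_hess_f]
    show "integrable M (\<lambda>\<omega>. \<epsilon> j \<omega> * partial i (partial i (f j)) (X \<omega>))"
      by (rule noise(1))
    show "expectation (\<lambda>\<omega>. \<epsilon> j \<omega> * partial i (partial i (f j)) (X \<omega>)) = 0"
      by (subst noise(2)) (simp_all only: eps_0 mult_zero_left)
  qed

  have non_child: "partial i (f j) x = 0" if "j \<notin> ch E i" for i j x
    by (rule partial_eq_0[where P="pa E j", OF f_pa]) (use that in \<open>simp_all add: pa_def ch_def\<close>)
  \<comment> \<open>Without self-loops the partial of \<open>f i\<close> in direction
    \<open>i\<close> vanishes, so the cross term in the square below is zero, and the Kronecker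
    delta equals its own square.\<close>
  have "i \<notin> ch E i" for i
    using dag by (auto simp: ch_def acyclic_def)
  then have sq: "(axis i 1 $ j - partial i (f j) x)\<^sup>2 = axis i 1 $ j + (partial i (f j) x)\<^sup>2" for i j x
    by (cases "i = j") (simp_all add: axis_def non_child)
  have formula: "SJIM M X p i i
      = 1 / \<sigma>\<^sup>2 + 1 / \<sigma>\<^sup>2 * (\<Sum>j\<in>ch E i. \<integral>\<omega>. (partial i (f j) (X \<omega>))\<^sup>2 \<partial>M)" for i
  proof -
    have "SJIM M X p i i = (\<integral>\<omega>. (\<Sum>j\<in>UNIV. axis i 1 $ j + (partial i (f j) (X \<omega>))\<^sup>2
        - \<epsilon> j \<omega> * partial i (partial i (f j)) (X \<omega>)) / \<sigma>\<^sup>2 \<partial>M)"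
      unfolding SJIM_def
    proof (rule Bochner_Integration.integral_cong[OF refl])
      fix \<omega> assume "\<omega> \<in> space M"
      then have "X \<omega> $ j - f j (X \<omega>) = \<epsilon> j \<omega>" for j
        using anm[of \<omega> j] by simp
      then show "- partial i (partial i (\<lambda>y. ln (p y))) (X \<omega>)
          = (\<Sum>j\<in>UNIV. axis i 1 $ j + (partial i (f j) (X \<omega>))\<^sup>2
            - \<epsilon> j \<omega> * partial i (partial i (f j)) (X \<omega>)) / \<sigma>\<^sup>2"
        by (simp add: pp sq sum_subtractf minus_divide_left)
    qed
    \<comment> \<open>The noise terms have mean zero, and the constants survive because the total
      mass is 1.\<close>
    also have "\<dots> = (\<Sum>j\<in>UNIV. axis i 1 $ j + (\<integral>\<omega>. (partial i (f j) (X \<omega>))\<^sup>2 \<partial>M)) / \<sigma>\<^sup>2"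
      by (simp add: int_grad noise_int noise_0 prob_space)
    also have "(\<Sum>j\<in>UNIV. axis i 1 $ j + (\<integral>\<omega>. (partial i (f j) (X \<omega>))\<^sup>2 \<partial>M))
        = 1 + (\<Sum>j\<in>UNIV. \<integral>\<omega>. (partial i (f j) (X \<omega>))\<^sup>2 \<partial>M)"
      by (simp add: sum.distrib axis_def)
    also have "(\<Sum>j\<in>UNIV. \<integral>\<omega>. (partial i (f j) (X \<omega>))\<^sup>2 \<partial>M)
        = (\<Sum>j\<in>ch E i. \<integral>\<omega>. (partial i (f j) (X \<omega>))\<^sup>2 \<partial>M)"
      by (rule sum.mono_neutral_right) (auto simp: non_child)
    finally show ?thesis
      by (simp add: add_divide_distrib)
  qed
  moreover have "(SJIM M X p l l = (MIN i. SJIM M X p i i) \<and> SJIM M X p l l = 1 / \<sigma>\<^sup>2) \<longleftrightarrow> ch E l = {}"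
    if pos: "\<forall>(j, i)\<in>E. (\<integral>\<omega>. (partial j (f i) (X \<omega>))\<^sup>2 \<partial>M) > 0" for l
  proof
    assume "ch E l = {}"
    then have l: "SJIM M X p l l = 1 / \<sigma>\<^sup>2"
      by (simp add: formula)
    \<comment> \<open>Each diagonal entry exceeds this bound by a sum of expected squares, so a
      sink, where the bound is attained, realises the minimum.\<close>
    have "1 / \<sigma>\<^sup>2 \<le> SJIM M X p i i" for i
      unfolding formula by (simp add: sum_nonneg)
    then have "(MIN i. SJIM M X p i i) = 1 / \<sigma>\<^sup>2"
      using l by (intro Min_eqI) (auto intro: range_eqI[where x=l])
    with l show "SJIM M X p l l = (MIN i. SJIM M X p i i) \<and> SJIM M X p l l = 1 / \<sigma>\<^sup>2"
      by simp
  next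
    assume "SJIM M X p l l = (MIN i. SJIM M X p i i) \<and> SJIM M X p l l = 1 / \<sigma>\<^sup>2"
    then have sum_0: "(\<Sum>j\<in>ch E l. \<integral>\<omega>. (partial l (f j) (X \<omega>))\<^sup>2 \<partial>M) = 0"
      using formula[of l] sigma_pos by simp
    show "ch E l = {}"
    proof (rule ccontr)
      assume "ch E l \<noteq> {}"
      then have "(\<Sum>j\<in>ch E l. \<integral>\<omega>. (partial l (f j) (X \<omega>))\<^sup>2 \<partial>M) > 0"
        using pos by (intro sum_pos) (auto simp: ch_def)
      with sum_0 show False by simp
    qed
  qed
  ultimately show ?thesis by blast
qed

end
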